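(* Fix $q\in(0,1)$. Let $\mathcal H_0\subseteq\{1,\ldots,m\}$ be any set of true nulls and, for $i\in\mathcal H_0$, let $\lambda_i\in[0,1)$. Suppose that for $i\in\mathcal H_0$ $$W_i=\lambda_iZ_0+\sqrt{1-\lambda_i^2}\,Z_i,$$ where $Z_0$ and $(Z_i)_{i\in\mathcal H_0}$ are independent standard normal variables. The nonnull score vector $(W_j)_{j\notin\mathcal H_0}$ may otherwise be arbitrary and may depend on $Z_0$, but it is required that, given $Z_0$, the nonnull vector $(W_j)_{j\notin\mathcal H_0}$ is independent of the null residuals $(Z_i)_{i\in\mathcal H_0}$. Then the knockoff+ threshold run at nominal level $q$ on $W_1,\ldots,W_m$ satisfies $$\mathrm{FDR}\le\frac{1+q}{2}.$$
   Context: For signed scores $W_1,\ldots,W_m$ and $t>0$, put $N_+(t)=\#\{i:W_i\ge t\}$, $N_-(t)=\#\{i:W_i\le -t\}$, and $\mathcal T=\{|W_i|:|W_i|>0\}$. The knockoff+ threshold at level $q$ is $$\widehat t=\min\Big\{t\in\mathcal T:\frac{1+N_-(t)}{N_+(t)\vee1}\le q\Big\},$$ with $\widehat t=\infty$ if the set is empty, and the rejection set is $\widehat{\mathcal R}=\{i:W_i\ge\widehat t\}$. Here $a\vee b=\max\{a,b\}$. The false discovery proportion is $\mathrm{FDP}=|\widehat{\mathcal R}\cap\mathcal H_0|/(|\widehat{\mathcal R}|\vee1)$ and $\mathrm{FDR}=\mathbb E(\mathrm{FDP})$. *)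

theory Defs
  imports "HOL-Probability.Probability"
begin

definition N_plus :: "nat \<Rightarrow> (nat \<Rightarrow> real) \<Rightarrow> real \<Rightarrow> nat" where
  "N_plus m w t = card {i \<in> {1..m}. w i \<ge> t}"

definition N_minus :: "nat \<Rightarrow> (nat \<Rightarrow> real) \<Rightarrow> real \<Rightarrow> nat" where
  "N_minus m w t = card {i \<in> {1..m}. w i \<le> - t}"

definition thresholds :: "nat \<Rightarrow> (nat \<Rightarrow> real) \<Rightarrow> real set" where
  "thresholds m w = {\<bar>w i\<bar> | i. i \<in> {1..m} \<and> \<bar>w i\<bar> > 0}"

definition admissible_thresholds :: "real \<Rightarrow> nat \<Rightarrow> (nat \<Rightarrow> real) \<Rightarrow> real set" where
  "admissible_thresholds q m w =
     {t \<in> thresholds m w. (1 + real (N_minus m w t)) / real (max (N_plus m w t) 1) \<le> q}"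

definition knockoff_plus_threshold :: "real \<Rightarrow> nat \<Rightarrow> (nat \<Rightarrow> real) \<Rightarrow> ereal" where
  "knockoff_plus_threshold q m w =
     (if admissible_thresholds q m w = {} then \<infinity>
      else ereal (Min (admissible_thresholds q m w)))"

definition rejections :: "real \<Rightarrow> nat \<Rightarrow> (nat \<Rightarrow> real) \<Rightarrow> nat set" where
  "rejections q m w = {i \<in> {1..m}. ereal (w i) \<ge> knockoff_plus_threshold q m w}"

definition FDP :: "real \<Rightarrow> nat \<Rightarrow> nat set \<Rightarrow> (nat \<Rightarrow> real) \<Rightarrow> real" where
  "FDP q m H0 w =
     real (card (rejections q m w \<inter> H0)) / real (max (card (rejections q m w)) 1)"

definition FDR :: "'a measure \<Rightarrow> real \<Rightarrow> nat \<Rightarrow> nat set \<Rightarrow> (nat \<Rightarrow> 'a \<Rightarrow> real) \<Rightarrow> real" where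
  "FDR M q m H0 W = (LINT \<omega>|M. FDP q m H0 (\<lambda>i. W i \<omega>))"

text \<open>
  Conditional independence of the random elements \<open>X\<close> (valued in \<open>N\<close>) and \<open>Y\<close> (valued in \<open>K\<close>)
  given the random element \<open>V\<close> (valued in \<open>L\<close>): conditionally on the sigma-algebra generated
  by \<open>V\<close>, the probability of \<open>X \<in> A \<and> Y \<in> B\<close> factorises almost surely. The exceptional
  set of measure zero may depend on \<open>A\<close> and \<open>B\<close>.
\<close>

definition cond_indep_var ::
  "'a measure \<Rightarrow> 'b measure \<Rightarrow> ('a \<Rightarrow> 'b) \<Rightarrow> 'c measure \<Rightarrow> ('a \<Rightarrow> 'c) \<Rightarrow> 'd measure \<Rightarrow> ('a \<Rightarrow> 'd) \<Rightarrow> bool"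
where
  "cond_indep_var M N X K Y L V \<longleftrightarrow>
     X \<in> measurable M N \<and> Y \<in> measurable M K \<and> V \<in> measurable M L \<and>
     (let G = vimage_algebra (space M) V L in
      \<forall>A \<in> sets N. \<forall>B \<in> sets K. AE \<omega> in M.
        real_cond_exp M G (indicator {x \<in> space M. X x \<in> A \<and> Y x \<in> B}) \<omega> =
        real_cond_exp M G (indicator {x \<in> space M. X x \<in> A}) \<omega> *
        real_cond_exp M G (indicator {x \<in> space M. Y x \<in> B}) \<omega>)"

end

theory Submission
  imports Defs
begin

text \<open>
  On the event \<open>Z 0 > 0\<close>, of probability at most one half, the false discovery proportion is
  bounded by one. On \<open>Z 0 \<le> 0\<close> every null score has a conditional mean \<open>\<le> 0\<close>, so that reflecting
  it at the origin shows that, given its magnitude, it is at most as likely to be positive as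
  negative, and the control at level \<open>q\<close> follows by a leave-one-out argument: with \<open>T\<^sub>i\<close> the
  threshold computed after replacing \<open>w i\<close> by its absolute value, the false discovery proportion is
  at most \<open>q\<close> times the sum over nulls with \<open>w i \<ge> T\<^sub>i\<close> of
  \<open>1 / (1 + #{j \<noteq> i null. w j \<le> - T\<^sub>i})\<close>. The weights do not see the sign of \<open>w i\<close>, so in expectation
  the condition \<open>w i \<ge> T\<^sub>i\<close> may be exchanged for \<open>w i \<le> - T\<^sub>i\<close>; the resulting sum is at most one
  pointwise, because all indices contributing to it share the same threshold.
\<close>

section \<open>Elementary facts on the threshold and the false discovery proportion\<close>

lemma finite_admissible_thresholds: "finite (admissible_thresholds q m w)"
proof -
  have "admissible_thresholds q m w \<subseteq> (\<lambda>i. \<bar>w i\<bar>) ` {1..m}"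
    by (auto simp: admissible_thresholds_def thresholds_def)
  then show ?thesis by (rule finite_subset) simp
qed

text \<open>The infimum of the empty set in \<open>ereal\<close> is infinity, so this form absorbs
  the case distinction of the definition. It yields upper bounds on the threshold and its
  measurability.\<close>

lemma knockoff_plus_threshold_eq_INF:
  "knockoff_plus_threshold q m w = (INF t\<in>admissible_thresholds q m w. ereal t)"
proof (cases "admissible_thresholds q m w = {}")
  case True
  then show ?thesis by (simp add: knockoff_plus_threshold_def top_ereal_def)
next
  case False
  note fin = finite_admissible_thresholds[of q m w]
  have "(INF t\<in>admissible_thresholds q m w. ereal t) = ereal (Min (admissible_thresholds q m w))"
    by (rule antisym) (auto intro!: INF_lower INF_greatest Min_in Min_le fin False)
  with False show ?thesis by (simp add: knockoff_plus_threshold_def)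
qed

lemma knockoff_plus_threshold_le:
  "t \<in> admissible_thresholds q m w \<Longrightarrow> knockoff_plus_threshold q m w \<le> ereal t"
  by (simp add: knockoff_plus_threshold_eq_INF INF_lower)

lemma knockoff_plus_threshold_cases:
  obtains (infinite) "knockoff_plus_threshold q m w = \<infinity>"
  | (finite) t where "knockoff_plus_threshold q m w = ereal t" "t \<in> admissible_thresholds q m w" "0 < t"
proof (cases "admissible_thresholds q m w = {}")
  case True
  then show ?thesis using infinite by (simp add: knockoff_plus_threshold_def)
next
  case False
  have "Min (admissible_thresholds q m w) \<in> admissible_thresholds q m w"
    using False finite_admissible_thresholds by (rule Min_in[rotated])
  moreover from this have "0 < Min (admissible_thresholds q m w)"
    by (auto simp: admissible_thresholds_def thresholds_def)
  ultimately show ?thesis using False finite by (simp add: knockoff_plus_threshold_def)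
qed

text \<open>This later allows the scores \<open>W\<close> to be exchanged for an explicit version
  that agrees with them, almost surely, on the indices \<open>{1..m}\<close> only.\<close>

lemma FDP_cong:
  assumes "\<And>i. i \<in> {1..m} \<Longrightarrow> v i = w i"
  shows "FDP q m H0 v = FDP q m H0 w"
proof -
  have "N_plus m v = N_plus m w" "N_minus m v = N_minus m w"
    using assms by (auto simp: N_plus_def N_minus_def fun_eq_iff intro!: arg_cong[of _ _ card])
  moreover have "thresholds m v = thresholds m w"
    unfolding thresholds_def using assms by (intro Collect_cong) metis
  ultimately have "knockoff_plus_threshold q m v = knockoff_plus_threshold q m w"
    by (simp add: knockoff_plus_threshold_def admissible_thresholds_def)
  then have "rejections q m v = rejections q m w"
    using assms by (auto simp: rejections_def)
  then show ?thesis by (simp add: FDP_def)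
qed

lemma FDP_le_1: "FDP q m H0 w \<le> 1"
proof -
  have "finite (rejections q m w)" by (simp add: rejections_def)
  then have "card (rejections q m w \<inter> H0) \<le> card (rejections q m w)"
    by (intro card_mono) auto
  then show ?thesis by (auto simp: FDP_def)
qed

section \<open>Leave-one-out weights and the two pointwise bounds\<close>

text \<open>Meant for a vector \<open>v\<close> whose entry \<open>i\<close> has been replaced by
  its absolute value: the threshold of \<open>v\<close> is then the leave-one-out threshold, and the
  condition says that the magnitude of score \<open>i\<close> reaches it. An infinite threshold
  fails the condition, since \<open>v i\<close> is real, and gives weight 0.\<close>

definition leave_one_out_weight :: "real \<Rightarrow> nat \<Rightarrow> nat set \<Rightarrow> nat \<Rightarrow> (nat \<Rightarrow> real) \<Rightarrow> real" where
  "leave_one_out_weight q m H0 i v =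
     (if knockoff_plus_threshold q m v \<le> ereal (v i)
      then 1 / (1 + real (card {j \<in> H0 - {i}. ereal (v j) \<le> - knockoff_plus_threshold q m v}))
      else 0)"

lemma leave_one_out_weight_nonneg: "0 \<le> leave_one_out_weight q m H0 i v"
  and leave_one_out_weight_le_1: "leave_one_out_weight q m H0 i v \<le> 1"
  by (simp_all add: leave_one_out_weight_def)

text \<open>A rejected score is positive, so taking its absolute value changes nothing and its
  leave-one-out threshold is the actual one, \<open>t\<close>. Admissibility of \<open>t\<close>
  trades the reciprocal of the number of rejections for \<open>q / (1 + N_minus m w t)\<close>, and
  \<open>N_minus\<close> counts at least the nulls other than \<open>i\<close> lying at or below
  \<open>- t\<close>.\<close>

lemma FDP_le_sum_leave_one_out:
  assumes H0: "H0 \<subseteq> {1..m}" and q: "0 < q"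
  shows "FDP q m H0 w \<le>
    q * (\<Sum>i\<in>H0. of_bool (0 < w i) * leave_one_out_weight q m H0 i (w(i := \<bar>w i\<bar>)))"
    (is "_ \<le> q * (\<Sum>i\<in>H0. ?f i)")
proof (cases rule: knockoff_plus_threshold_cases[of q m w])
  case infinite
  then have "FDP q m H0 w = 0" by (simp add: FDP_def rejections_def)
  with q show ?thesis by (simp add: sum_nonneg leave_one_out_weight_nonneg)
next
  case (finite t)
  have finH0: "finite H0" using H0 by (rule finite_subset) simp
  define R where "R = {i \<in> {1..m}. t \<le> w i}"
  have R: "rejections q m w = R" "N_plus m w t = card R"
    using finite by (simp_all add: rejections_def N_plus_def R_def)
  let ?N = "N_minus m w t"
  have "1 + real ?N \<le> q * real (max (card R) 1)"
    using finite(2) by (auto simp: admissible_thresholds_def R pos_divide_le_eq)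
  then have "1 / real (max (card R) 1) \<le> q / (1 + real ?N)"
    by (simp add: field_simps)
  then have "FDP q m H0 w \<le> real (card (R \<inter> H0)) * (q / (1 + real ?N))"
    by (auto dest: mult_left_mono[where c="real (card (R \<inter> H0))"] simp: FDP_def R)
  also have "\<dots> = q * (\<Sum>i\<in>R \<inter> H0. 1 / (1 + real ?N))"
    by simp
  also have "(\<Sum>i\<in>R \<inter> H0. 1 / (1 + real ?N)) \<le> (\<Sum>i\<in>R \<inter> H0. ?f i)"
  proof (rule sum_mono)
    fix i assume i: "i \<in> R \<inter> H0"
    then have wi: "t \<le> w i" "0 < w i" using \<open>0 < t\<close> by (auto simp: R_def)
    then have flip: "w(i := \<bar>w i\<bar>) = w" by auto
    have "card {j \<in> H0 - {i}. w j \<le> - t} \<le> ?N"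
      unfolding N_minus_def using H0 by (intro card_mono) auto
    then show "1 / (1 + real ?N) \<le> ?f i"
      using wi by (simp add: flip leave_one_out_weight_def finite(1) frac_le)
  qed
  also have "(\<Sum>i\<in>R \<inter> H0. ?f i) \<le> (\<Sum>i\<in>H0. ?f i)"
    using finH0 by (intro sum_mono2) (auto simp: leave_one_out_weight_nonneg)
  finally show ?thesis using q by simp
qed

text \<open>
  When \<open>w i\<close> and \<open>w j\<close> are both negative, making either one positive yields the same counts at
  every level not exceeding both magnitudes, hence the symmetry behind the next lemma.
\<close>
lemma leave_one_out_threshold_le:
  assumes ij: "i \<in> {1..m}" "j \<in> {1..m}" and neg: "w i < 0" "w j < 0"
    and i: "knockoff_plus_threshold q m (w(i := \<bar>w i\<bar>)) \<le> ereal \<bar>w i\<bar>"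
    and j: "knockoff_plus_threshold q m (w(j := \<bar>w j\<bar>)) \<le> ereal \<bar>w j\<bar>"
  shows "knockoff_plus_threshold q m (w(j := \<bar>w j\<bar>)) \<le> knockoff_plus_threshold q m (w(i := \<bar>w i\<bar>))"
proof (rule ccontr)
  let ?T = "knockoff_plus_threshold q m" and ?w = "\<lambda>i. w(i := \<bar>w i\<bar>)"
  assume "\<not> ?T (?w j) \<le> ?T (?w i)"
  then have less: "?T (?w i) < ?T (?w j)" by simp
  then have "i \<noteq> j" by auto
  obtain t where t: "?T (?w i) = ereal t" "t \<in> admissible_thresholds q m (?w i)" "0 < t"
    using less by (cases rule: knockoff_plus_threshold_cases[of q m "?w i"]) auto
  have ti: "t \<le> \<bar>w i\<bar>" using i t by simp
  \<comment> \<open>For \<open>j\<close> the bound comes from the inequality assumed for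
    contradiction: \<open>t\<close> lies below the threshold of \<open>?w j\<close>, which is at
    most the magnitude of \<open>w j\<close>.\<close>
  have tj: "t \<le> \<bar>w j\<bar>"
    using less_le_trans[OF less j] t by simp
  have "N_plus m (?w i) t = N_plus m (?w j) t"
  proof -
    \<comment> \<open>Away from \<open>i\<close> and \<open>j\<close> the two vectors coincide. At
      level \<open>t\<close>, exactly one of the two indices joins the positive count and the other
      one joins the negative count, in either vector.\<close>
    define P where "P = {k \<in> {1..m} - {i, j}. t \<le> w k}"
    have "{k \<in> {1..m}. t \<le> ?w i k} = insert i P" "{k \<in> {1..m}. t \<le> ?w j k} = insert j P"
      using ij neg ti tj t \<open>i \<noteq> j\<close> by (auto simp: P_def)
    then show ?thesis by (simp add: N_plus_def P_def)
  qed
  moreover have "N_minus m (?w i) t = N_minus m (?w j) t"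
  proof -
    define P where "P = {k \<in> {1..m} - {i, j}. w k \<le> - t}"
    have "{k \<in> {1..m}. ?w i k \<le> - t} = insert j P" "{k \<in> {1..m}. ?w j k \<le> - t} = insert i P"
      using ij neg ti tj t \<open>i \<noteq> j\<close> by (auto simp: P_def)
    then show ?thesis by (simp add: N_minus_def P_def)
  qed
  moreover have "thresholds m (?w i) = thresholds m (?w j)"
  proof -
    have "\<bar>?w i k\<bar> = \<bar>?w j k\<bar>" for k by simp
    then show ?thesis unfolding thresholds_def by presburger
  qed
  ultimately have "t \<in> admissible_thresholds q m (?w j)"
    using t(2) by (simp add: admissible_thresholds_def)
  from knockoff_plus_threshold_le[OF this] less t show False by simp
qed

text \<open>Let \<open>S\<close> be the set of indices with a nonzero term. Applying the preceding
  lemma in both directions, all of \<open>S\<close> shares one threshold, so every other member of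
  \<open>S\<close> is counted in the denominator of the weight of \<open>i\<close>. Each term is
  thus at most \<open>1 / card S\<close>.\<close>

lemma sum_leave_one_out_neg_le_1:
  assumes H0: "H0 \<subseteq> {1..m}"
  shows "(\<Sum>i\<in>H0. of_bool (w i < 0) * leave_one_out_weight q m H0 i (w(i := \<bar>w i\<bar>))) \<le> 1"
proof -
  have finH0: "finite H0" using H0 by (rule finite_subset) simp
  let ?T = "\<lambda>i. knockoff_plus_threshold q m (w(i := \<bar>w i\<bar>))"
  define S where "S = {i \<in> H0. w i < 0 \<and> ?T i \<le> ereal \<bar>w i\<bar>}"
  have finS: "finite S" using finH0 by (simp add: S_def)
  have eq: "?T i = ?T j" if "i \<in> S" "j \<in> S" for i j
    using that H0 by (intro antisym leave_one_out_threshold_le) (auto simp: S_def)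
  have "(\<Sum>i\<in>H0. of_bool (w i < 0) * leave_one_out_weight q m H0 i (w(i := \<bar>w i\<bar>)))
      = (\<Sum>i\<in>S. leave_one_out_weight q m H0 i (w(i := \<bar>w i\<bar>)))"
    by (rule sum.mono_neutral_cong_right)
      (use finH0 in \<open>auto simp: S_def leave_one_out_weight_def\<close>)
  also have "\<dots> \<le> (\<Sum>i\<in>S. 1 / real (card S))"
  proof (rule sum_mono)
    fix i assume i: "i \<in> S"
    let ?C = "{j \<in> H0 - {i}. ereal ((w(i := \<bar>w i\<bar>)) j) \<le> - ?T i}"
    have "S - {i} \<subseteq> ?C"
    proof
      fix j assume j: "j \<in> S - {i}"
      then have "?T i \<le> ereal \<bar>w j\<bar>" "w j < 0" "j \<in> H0" using eq[of j i] i by (auto simp: S_def)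
      then have "ereal (w j) \<le> - ?T i"
        using ereal_minus_le_minus[of "ereal \<bar>w j\<bar>" "?T i"] by simp
      with j \<open>j \<in> H0\<close> show "j \<in> ?C" by auto
    qed
    then have "card (S - {i}) \<le> card ?C"
      using finH0 by (intro card_mono) auto
    moreover have "card S = Suc (card (S - {i}))"
      using finS i by (rule card.remove)
    ultimately have "real (card S) \<le> 1 + real (card ?C)" by simp
    moreover have "0 < card S" using i finS by (auto simp: card_gt_0_iff)
    moreover have "?T i \<le> ereal \<bar>w i\<bar>" using i unfolding S_def by blast
    ultimately show "leave_one_out_weight q m H0 i (w(i := \<bar>w i\<bar>)) \<le> 1 / real (card S)"
      by (simp only: leave_one_out_weight_def fun_upd_same if_True) (intro frac_le; simp)
  qed
  also have "\<dots> \<le> 1" by simp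
  finally show ?thesis .
qed

section \<open>Measurability of the threshold and of the weights\<close>

text \<open>The candidate thresholds vary with \<open>x\<close>. Rewriting the infimum over the
  fixed index set \<open>{1..m}\<close>, with the value infinity at indices whose magnitude is not
  admissible, leaves a finite infimum of measurable functions.\<close>

lemma measurable_knockoff_plus_threshold:
  fixes w :: "'b \<Rightarrow> nat \<Rightarrow> real"
  assumes "\<And>i. i \<in> {1..m} \<Longrightarrow> (\<lambda>x. w x i) \<in> borel_measurable M"
  shows "(\<lambda>x. knockoff_plus_threshold q m (w x)) \<in> borel_measurable M"
proof -
  \<comment> \<open>Setting the entries outside \<open>{1..m}\<close> to zero makes every coordinate
    measurable without a side condition on the index.\<close>
  define v where "v i x = (if i \<in> {1..m} then w x i else 0)" for i x
  have [measurable]: "v i \<in> borel_measurable M" for i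
    using assms by (cases "i \<in> {1..m}") (simp_all add: v_def[abs_def] del: atLeastAtMost_iff)
  have *: "knockoff_plus_threshold q m (w x) =
      (INF i\<in>{1..m}. if \<bar>v i x\<bar> > 0 \<and>
        (1 + real (card {j \<in> {1..m}. v j x \<le> - \<bar>v i x\<bar>})) /
          real (max (card {j \<in> {1..m}. v j x \<ge> \<bar>v i x\<bar>}) 1) \<le> q
        then ereal \<bar>v i x\<bar> else \<infinity>)" (is "_ = (INF i\<in>_. ?F i)") for x
  proof -
    have N: "N_minus m (w x) t = card {j \<in> {1..m}. v j x \<le> - t}"
      "N_plus m (w x) t = card {j \<in> {1..m}. v j x \<ge> t}" for t
      by (auto simp: N_minus_def N_plus_def v_def intro!: arg_cong[of _ _ card])
    show ?thesis
      unfolding knockoff_plus_threshold_eq_INF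
    proof (rule antisym)
      show "(INF t\<in>admissible_thresholds q m (w x). ereal t) \<le> (INF i\<in>{1..m}. ?F i)"
      proof (rule INF_greatest)
        fix i assume i: "i \<in> {1..m}"
        then have "v i x = w x i" by (simp add: v_def)
        then show "(INF t\<in>admissible_thresholds q m (w x). ereal t) \<le> ?F i"
          using i by (auto intro!: INF_lower simp: admissible_thresholds_def thresholds_def N)
      qed
      show "(INF i\<in>{1..m}. ?F i) \<le> (INF t\<in>admissible_thresholds q m (w x). ereal t)"
      proof (rule INF_greatest)
        fix t assume t: "t \<in> admissible_thresholds q m (w x)"
        then obtain i where i: "i \<in> {1..m}" "t = \<bar>w x i\<bar>" "w x i \<noteq> 0"
          by (auto simp: admissible_thresholds_def thresholds_def)
        then have "v i x = w x i" by (simp add: v_def)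
        then have "?F i \<le> ereal t"
          using t i by (simp add: admissible_thresholds_def thresholds_def N)
        then show "(INF i\<in>{1..m}. ?F i) \<le> ereal t"
          by (rule INF_lower2[OF i(1)])
      qed
    qed
  qed
  show ?thesis unfolding * by measurable
qed

lemma measurable_leave_one_out_weight:
  fixes w :: "'b \<Rightarrow> nat \<Rightarrow> real"
  assumes H0: "H0 \<subseteq> {1..m}" "i \<in> H0"
    and w: "\<And>i. i \<in> {1..m} \<Longrightarrow> (\<lambda>x. w x i) \<in> borel_measurable M"
  shows "(\<lambda>x. leave_one_out_weight q m H0 i (w x)) \<in> borel_measurable M"
proof -
  define v where "v i x = (if i \<in> {1..m} then w x i else 0)" for i x
  have [measurable]: "v i \<in> borel_measurable M" for i
    using w by (cases "i \<in> {1..m}") (simp_all add: v_def[abs_def] del: atLeastAtMost_iff)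
  have [measurable]: "(\<lambda>x. knockoff_plus_threshold q m (w x)) \<in> borel_measurable M"
    using w by (rule measurable_knockoff_plus_threshold)
  have *: "leave_one_out_weight q m H0 i (w x) =
     (if knockoff_plus_threshold q m (w x) \<le> ereal (v i x)
      then 1 / (1 + real (card {j \<in> H0 - {i}. ereal (v j x) \<le> - knockoff_plus_threshold q m (w x)}))
      else 0)" for x
  proof -
    have "v j x = w x j" if "j \<in> H0" for j using that H0 by (auto simp: v_def)
    then have "{j \<in> H0 - {i}. ereal (v j x) \<le> - knockoff_plus_threshold q m (w x)} =
       {j \<in> H0 - {i}. ereal (w x j) \<le> - knockoff_plus_threshold q m (w x)}" "v i x = w x i"
      using H0 by auto
    then show ?thesis by (simp add: leave_one_out_weight_def)
  qed
  show ?thesis unfolding * by measurable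
qed

section \<open>From conditional independence to a product law\<close>

text \<open>If \<open>Y\<close> is independent of \<open>V\<close>, its conditional probabilities
  given \<open>V\<close> are constant. Conditional factorisation, integrated over an event of
  \<open>V\<close>, then makes the pair \<open>(X, V)\<close> independent of \<open>Y\<close>. The
  product form of the law is what Fubini's theorem uses later.\<close>

lemma (in prob_space) distr_Pair_of_cond_indep_var:
  assumes ci: "cond_indep_var M N X K Y L V"
    and YV: "\<And>C B. C \<in> sets L \<Longrightarrow> B \<in> sets K \<Longrightarrow>
      prob (V -` C \<inter> space M \<inter> (Y -` B \<inter> space M)) = prob (V -` C \<inter> space M) * prob (Y -` B \<inter> space M)"
  shows "distr M ((N \<Otimes>\<^sub>M L) \<Otimes>\<^sub>M K) (\<lambda>\<omega>. ((X \<omega>, V \<omega>), Y \<omega>)) =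
    distr M (N \<Otimes>\<^sub>M L) (\<lambda>\<omega>. (X \<omega>, V \<omega>)) \<Otimes>\<^sub>M distr M K Y"
proof -
  have [measurable]: "X \<in> measurable M N" "Y \<in> measurable M K" "V \<in> measurable M L"
    using ci by (auto simp: cond_indep_var_def)
  define G where "G = vimage_algebra (space M) V L"
  have V_space: "V \<in> space M \<rightarrow> space L" using measurable_space[of V M L] by auto
  have sets_G: "sets G = {V -` C \<inter> space M | C. C \<in> sets L}"
    unfolding G_def by (rule sets_vimage_algebra2[OF V_space])
  have sub: "subalgebra M G"
  proof -
    have "sets G \<subseteq> sets M" by (auto simp: sets_G)
    then show ?thesis by (simp add: subalgebra_def G_def)
  qed
  interpret G: finite_measure_subalgebra M G by standard (rule sub)
  have rect: "prob ((\<lambda>\<omega>. (X \<omega>, V \<omega>)) -` (A \<times> C) \<inter> space M \<inter> (Y -` B \<inter> space M)) =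
      prob ((\<lambda>\<omega>. (X \<omega>, V \<omega>)) -` (A \<times> C) \<inter> space M) * prob (Y -` B \<inter> space M)"
    if [measurable]: "A \<in> sets N" "C \<in> sets L" "B \<in> sets K" for A B C
  proof -
    define EA EB EC EAB where E_defs: "EA = {x \<in> space M. X x \<in> A}" "EB = {x \<in> space M. Y x \<in> B}"
      "EC = V -` C \<inter> space M" "EAB = {x \<in> space M. X x \<in> A \<and> Y x \<in> B}"
    have [measurable]: "EA \<in> sets M" "EB \<in> sets M" "EC \<in> sets M" "EAB \<in> sets M"
      by (auto simp: E_defs)
    have EC: "EC \<in> sets G" using that by (auto simp: sets_G E_defs)
    let ?E = "\<lambda>D. real_cond_exp M G (indicator D)"
    \<comment> \<open>By \<open>YV\<close> the constant \<open>prob EB\<close> has the same integral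
      as the indicator of \<open>EB\<close> over every event of \<open>G\<close>, which
      characterises the conditional expectation.\<close>
    have B: "AE \<omega> in M. ?E EB \<omega> = prob EB"
    proof (rule G.real_cond_exp_charact)
      fix D assume "D \<in> sets G"
      then obtain C' where C': "C' \<in> sets L" "D = V -` C' \<inter> space M" by (auto simp: sets_G)
      then have [measurable]: "D \<in> sets M" by auto
      have "prob (D \<inter> EB) = prob D * prob EB"
        using YV[OF C'(1) \<open>B \<in> sets K\<close>] C'
        by (simp add: E_defs vimage_def Int_def conj_ac)
      moreover have "(\<integral>x\<in>D. indicator EB x \<partial>M) = prob (D \<inter> EB)"
        by (simp add: set_lebesgue_integral_def flip: indicator_inter_arith)
      moreover have "(\<integral>x\<in>D. prob EB \<partial>M) = prob D * prob EB"
        by (simp add: set_lebesgue_integral_def)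
      ultimately show "(\<integral>x\<in>D. indicator EB x \<partial>M) = (\<integral>x\<in>D. prob EB \<partial>M)" by simp
    qed (auto simp: less_top[symmetric])
    have AB: "AE \<omega> in M. ?E EAB \<omega> = ?E EA \<omega> * ?E EB \<omega>"
      using ci that unfolding cond_indep_var_def Let_def G_def E_defs by blast
    have ind: "(\<integral>x\<in>EC. ?E D x \<partial>M) = prob (EC \<inter> D)" if [measurable]: "D \<in> sets M" for D
      by (subst G.real_cond_exp_intA[symmetric, OF _ EC])
        (simp_all add: less_top[symmetric] set_lebesgue_integral_def flip: indicator_inter_arith)
    have "prob (EC \<inter> EAB) = (\<integral>x\<in>EC. ?E EAB x \<partial>M)" by (simp add: ind)
    also have "\<dots> = (\<integral>x\<in>EC. ?E EA x * prob EB \<partial>M)"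
      unfolding set_lebesgue_integral_def using AB B
      by (intro integral_cong_AE) auto
    also have "\<dots> = prob (EC \<inter> EA) * prob EB" by (simp add: ind)
    finally have "prob (EC \<inter> EAB) = prob (EC \<inter> EA) * prob EB" .
    moreover have "EC \<inter> EAB = (\<lambda>\<omega>. (X \<omega>, V \<omega>)) -` (A \<times> C) \<inter> space M \<inter> (Y -` B \<inter> space M)"
      "EC \<inter> EA = (\<lambda>\<omega>. (X \<omega>, V \<omega>)) -` (A \<times> C) \<inter> space M" "EB = Y -` B \<inter> space M"
      by (auto simp: E_defs)
    ultimately show ?thesis by simp
  qed
  \<comment> \<open>Preimages of rectangles are stable under intersection and generate the
    sigma-algebra of \<open>(X, V)\<close>, so the factorisation extends from rectangles to all
    product-measurable sets.\<close>
  let ?R = "{A \<times> C | A C. A \<in> sets N \<and> C \<in> sets L}"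
  let ?P = "{(\<lambda>\<omega>. (X \<omega>, V \<omega>)) -` E \<inter> space M | E. E \<in> ?R}"
  let ?Q = "{Y -` B \<inter> space M | B. B \<in> sets K}"
  have "indep_set ?P ?Q"
    by (rule indep_setI) (auto intro!: rect)
  moreover have "Int_stable ?P"
  proof (safe intro!: Int_stableI)
    fix A A' C C' assume "A \<in> sets N" "A' \<in> sets N" "C \<in> sets L" "C' \<in> sets L"
    then show "\<exists>E. (\<lambda>\<omega>. (X \<omega>, V \<omega>)) -` (A \<times> C) \<inter> space M \<inter> ((\<lambda>\<omega>. (X \<omega>, V \<omega>)) -` (A' \<times> C') \<inter> space M)
        = (\<lambda>\<omega>. (X \<omega>, V \<omega>)) -` E \<inter> space M \<and> E \<in> ?R"
      by (intro exI[of _ "(A \<inter> A') \<times> (C \<inter> C')"]) auto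
  qed
  moreover have "Int_stable ?Q"
  proof (safe intro!: Int_stableI)
    fix B B' assume "B \<in> sets K" "B' \<in> sets K"
    then show "\<exists>D. Y -` B \<inter> space M \<inter> (Y -` B' \<inter> space M) = Y -` D \<inter> space M \<and> D \<in> sets K"
      by (intro exI[of _ "B \<inter> B'"]) auto
  qed
  ultimately have "indep_set (sigma_sets (space M) ?P) (sigma_sets (space M) ?Q)"
    by (rule indep_set_sigma_sets)
  moreover have "{(\<lambda>\<omega>. (X \<omega>, V \<omega>)) -` E \<inter> space M | E. E \<in> sets (N \<Otimes>\<^sub>M L)} = sigma_sets (space M) ?P"
    unfolding sets_pair_measure
    by (rule sigma_sets_vimage_commute) (use V_space measurable_space[of X M N] in auto)
  moreover have "sigma_sets (space M) ?Q = ?Q"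
    using sets_vimage_algebra2[of Y "space M" K] measurable_space[of Y M K]
    by (auto simp: sets_vimage_algebra)
  ultimately have indep: "indep_set {(\<lambda>\<omega>. (X \<omega>, V \<omega>)) -` E \<inter> space M | E. E \<in> sets (N \<Otimes>\<^sub>M L)} ?Q"
    by simp
  interpret XV: prob_space "distr M (N \<Otimes>\<^sub>M L) (\<lambda>\<omega>. (X \<omega>, V \<omega>))" by (rule prob_space_distr) measurable
  interpret Y: prob_space "distr M K Y" by (rule prob_space_distr) measurable
  show ?thesis
  proof (rule pair_measure_eqI[symmetric])
    fix E B assume "E \<in> sets (distr M (N \<Otimes>\<^sub>M L) (\<lambda>\<omega>. (X \<omega>, V \<omega>)))" "B \<in> sets (distr M K Y)"
    then have [measurable]: "E \<in> sets (N \<Otimes>\<^sub>M L)" "B \<in> sets K" by simp_all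
    have "(\<lambda>\<omega>. ((X \<omega>, V \<omega>), Y \<omega>)) -` (E \<times> B) \<inter> space M =
        ((\<lambda>\<omega>. (X \<omega>, V \<omega>)) -` E \<inter> space M) \<inter> (Y -` B \<inter> space M)" by auto
    moreover have "prob (((\<lambda>\<omega>. (X \<omega>, V \<omega>)) -` E \<inter> space M) \<inter> (Y -` B \<inter> space M)) =
        prob ((\<lambda>\<omega>. (X \<omega>, V \<omega>)) -` E \<inter> space M) * prob (Y -` B \<inter> space M)"
      by (rule indep_setD[OF indep]) auto
    ultimately show "emeasure (distr M (N \<Otimes>\<^sub>M L) (\<lambda>\<omega>. (X \<omega>, V \<omega>))) E * emeasure (distr M K Y) B =
        emeasure (distr M ((N \<Otimes>\<^sub>M L) \<Otimes>\<^sub>M K) (\<lambda>\<omega>. ((X \<omega>, V \<omega>), Y \<omega>))) (E \<times> B)"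
      by (simp add: emeasure_distr emeasure_eq_measure ennreal_mult)
  qed (auto intro: XV.sigma_finite_measure_axioms Y.sigma_finite_measure_axioms)
qed

section \<open>Reflection inequalities for the normal law\<close>

lemma std_normal_density_antimono: "\<bar>x\<bar> \<le> \<bar>y\<bar> \<Longrightarrow> std_normal_density y \<le> std_normal_density x"
  by (simp add: std_normal_density_def abs_le_square_iff divide_right_mono)

lemma nn_integral_std_normal_shifted_sign_le:
  fixes h :: "real \<Rightarrow> ennreal"
  assumes [measurable]: "h \<in> borel_measurable borel" and b: "0 < b" and c: "c \<le> 0"
  shows "(\<integral>\<^sup>+z. of_bool (0 < c + b * z) * h \<bar>c + b * z\<bar> \<partial>density lborel std_normal_density)
       \<le> (\<integral>\<^sup>+z. of_bool (c + b * z < 0) * h \<bar>c + b * z\<bar> \<partial>density lborel std_normal_density)"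
proof -
  \<comment> \<open>The reflection \<open>z \<mapsto> 2 * d - z\<close> changes the sign of \<open>c + b * z\<close>; as \<open>0 \<le> d\<close>, it moves points
    of the half-line beyond \<open>d\<close> closer to the origin, where the density is larger.\<close>
  define d where "d = - c / b"
  have "0 \<le> d" using b c by (simp add: d_def divide_nonpos_pos)
  have refl: "c + b * (2 * d + (- 1) * z) = - (c + b * z)" for z
    using b by (simp add: d_def field_simps)
  have pos: "d < z" if "0 < c + b * z" for z
    using that b unfolding d_def by (subst pos_divide_less_eq) (auto simp: mult.commute)
  have "(\<integral>\<^sup>+z. of_bool (0 < c + b * z) * h \<bar>c + b * z\<bar> \<partial>density lborel std_normal_density)
      = (\<integral>\<^sup>+z. ennreal (std_normal_density z) * (of_bool (0 < c + b * z) * h \<bar>c + b * z\<bar>) \<partial>lborel)"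
    by (subst nn_integral_density) auto
  also have "\<dots> \<le> (\<integral>\<^sup>+z. ennreal (std_normal_density (2 * d + (- 1) * z)) *
      (of_bool (0 < c + b * z) * h \<bar>c + b * z\<bar>) \<partial>lborel)"
  proof (rule nn_integral_mono)
    fix z
    show "ennreal (std_normal_density z) * (of_bool (0 < c + b * z) * h \<bar>c + b * z\<bar>)
       \<le> ennreal (std_normal_density (2 * d + (- 1) * z)) * (of_bool (0 < c + b * z) * h \<bar>c + b * z\<bar>)"
    proof (cases "0 < c + b * z")
      case True
      have "\<bar>2 * d + (- 1) * z\<bar> \<le> \<bar>z\<bar>" using pos[OF True] \<open>0 \<le> d\<close> by auto
      then show ?thesis by (intro mult_right_mono ennreal_leI std_normal_density_antimono) auto
    qed simp
  qed
  \<comment> \<open>The score is positive at \<open>z\<close> exactly when it is negative at the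
    reflected point, with the same magnitude. The integrand thus depends on the reflected point
    alone, and a substitution of slope -1 preserves Lebesgue measure.\<close>
  also have "\<dots> = (\<integral>\<^sup>+z. ennreal (std_normal_density (2 * d + (- 1) * z)) *
      (of_bool (c + b * (2 * d + (- 1) * z) < 0) * h \<bar>c + b * (2 * d + (- 1) * z)\<bar>) \<partial>lborel)"
    unfolding refl by (simp only: abs_minus_cancel neg_less_0_iff_less)
  also have "\<dots> = (\<integral>\<^sup>+z. ennreal (std_normal_density z) * (of_bool (c + b * z < 0) * h \<bar>c + b * z\<bar>) \<partial>lborel)"
    by (subst nn_integral_real_affine[where c="-1" and t="2 * d"]) auto
  also have "\<dots> = (\<integral>\<^sup>+z. of_bool (c + b * z < 0) * h \<bar>c + b * z\<bar> \<partial>density lborel std_normal_density)"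
    by (subst nn_integral_density) auto
  finally show ?thesis .
qed

text \<open>The parameters \<open>z0\<close> and \<open>v\<close> stand for the conditioning on
  \<open>Z 0\<close> and the nonnull scores. Freezing also the residuals other than \<open>i\<close>
  leaves an integral over one normal variable \<open>z\<close>. Score \<open>i\<close> is
  \<open>?c + ?b * z\<close> with \<open>?c\<close> nonpositive and \<open>?b\<close> positive, so
  the one-dimensional inequality applies.\<close>

lemma nn_integral_null_sign_le:
  fixes l v :: "nat \<Rightarrow> real" and z0 :: real
    and H0 :: "nat set" and w :: "(nat \<Rightarrow> real) \<Rightarrow> nat \<Rightarrow> real"
  defines "w \<equiv> \<lambda>y j. if j \<in> H0 then l j * z0 + sqrt (1 - (l j)\<^sup>2) * y j else v j"
  assumes H0: "H0 \<subseteq> {1..m}" "i \<in> H0" and l: "0 \<le> l i" "l i < 1" and z0: "z0 \<le> 0"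
  shows "(\<integral>\<^sup>+y. of_bool (0 < w y i) * ennreal (leave_one_out_weight q m H0 i ((w y)(i := \<bar>w y i\<bar>)))
      \<partial>PiM H0 (\<lambda>_. density lborel std_normal_density))
    \<le> (\<integral>\<^sup>+y. of_bool (w y i < 0) * ennreal (leave_one_out_weight q m H0 i ((w y)(i := \<bar>w y i\<bar>)))
      \<partial>PiM H0 (\<lambda>_. density lborel std_normal_density))"
    (is "(\<integral>\<^sup>+y. ?F y \<partial>?P H0) \<le> (\<integral>\<^sup>+y. ?G y \<partial>_)")
proof -
  define J where "J = H0 - {i}"
  have J: "H0 = insert i J" "i \<notin> J" "finite J"
    using H0 finite_subset[OF H0(1)] by (auto simp: J_def)
  interpret product_sigma_finite "\<lambda>_::nat. density lborel std_normal_density"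
    by (intro product_sigma_finite.intro prob_space_imp_sigma_finite prob_space_normal_density) simp
  let ?b = "sqrt (1 - (l i)\<^sup>2)" and ?c = "l i * z0"
  have b: "0 < ?b" using l by (simp add: abs_square_less_1)
  have c: "?c \<le> 0" using l z0 by (simp add: mult_nonneg_nonpos)
  have [measurable]: "(\<lambda>y. w y j) \<in> borel_measurable (?P H0)" for j
    unfolding w_def by (cases "j \<in> H0") (auto intro!: measurable_component_singleton)
  have L: "(\<lambda>y. leave_one_out_weight q m H0 i ((w y)(i := \<bar>w y i\<bar>))) \<in> borel_measurable (?P H0)"
    using H0 by (rule measurable_leave_one_out_weight) (auto simp: fun_upd_apply)
  have split: "(\<integral>\<^sup>+y. f y \<partial>?P H0) = (\<integral>\<^sup>+y. \<integral>\<^sup>+z. f (y(i := z)) \<partial>density lborel std_normal_density \<partial>?P J)"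
    if "f \<in> borel_measurable (?P H0)" for f
    using product_nn_integral_insert[OF J(3,2), of f] that by (simp add: J(1))
  show ?thesis
  proof (subst (1 2) split)
    show "?F \<in> borel_measurable (?P H0)" "?G \<in> borel_measurable (?P H0)"
      using L by measurable
    show "(\<integral>\<^sup>+y. \<integral>\<^sup>+z. ?F (y(i := z)) \<partial>density lborel std_normal_density \<partial>?P J)
        \<le> (\<integral>\<^sup>+y. \<integral>\<^sup>+z. ?G (y(i := z)) \<partial>density lborel std_normal_density \<partial>?P J)"
    proof (rule nn_integral_mono)
      fix y
      define h where "h u = ennreal (leave_one_out_weight q m H0 i ((w y)(i := u)))" for u
      have "(\<lambda>u. leave_one_out_weight q m H0 i ((w y)(i := u))) \<in> borel_measurable borel"
        using H0 by (rule measurable_leave_one_out_weight) (auto simp: fun_upd_apply)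
      then have h: "h \<in> borel_measurable borel" by (simp add: h_def[abs_def])
      have wi: "w (y(i := z)) i = ?c + ?b * z" for z using H0 by (simp add: w_def)
      \<comment> \<open>Only entry \<open>i\<close> depends on \<open>z\<close>, and it is
        overwritten; hence the weight sees \<open>z\<close> through the magnitude of score
        \<open>i\<close> alone.\<close>
      have "(w (y(i := z)))(i := u) = (w y)(i := u)" for z u
        by (auto simp: w_def)
      then show "(\<integral>\<^sup>+z. ?F (y(i := z)) \<partial>density lborel std_normal_density)
          \<le> (\<integral>\<^sup>+z. ?G (y(i := z)) \<partial>density lborel std_normal_density)"
        using nn_integral_std_normal_shifted_sign_le[OF h b c] by (simp add: wi h_def)
    qed
  qed
qed

text \<open>The reflection inequality with shift 0, slope 1 and constant weight compares the
  positive with the negative half-line; these are disjoint events, so the smaller probability is at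
  most one half.\<close>

lemma (in prob_space) prob_std_normal_pos_le_half:
  assumes "distributed M lborel Z std_normal_density"
  shows "prob {\<omega> \<in> space M. 0 < Z \<omega>} \<le> 1 / 2"
proof -
  have [measurable]: "Z \<in> borel_measurable M"
    using distributed_measurable[OF assms] by simp
  have D: "density lborel std_normal_density = distr M lborel Z"
    using distributed_distr_eq_density[OF assms] by simp
  have "(\<integral>\<^sup>+z. of_bool (0 < z) \<partial>distr M lborel Z) \<le> (\<integral>\<^sup>+z. of_bool (z < 0) \<partial>distr M lborel Z)"
    using nn_integral_std_normal_shifted_sign_le[of "\<lambda>_. 1" 1 0] by (simp add: D)
  moreover have "(\<integral>\<^sup>+z. of_bool (0 < z) \<partial>distr M lborel Z) = emeasure M {\<omega> \<in> space M. 0 < Z \<omega>}"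
    by (subst nn_integral_distr) (auto simp: indicator_def of_bool_def simp flip: nn_integral_indicator intro!: nn_integral_cong)
  moreover have "(\<integral>\<^sup>+z. of_bool (z < 0) \<partial>distr M lborel Z) = emeasure M {\<omega> \<in> space M. Z \<omega> < 0}"
    by (subst nn_integral_distr) (auto simp: indicator_def of_bool_def simp flip: nn_integral_indicator intro!: nn_integral_cong)
  ultimately have "prob {\<omega> \<in> space M. 0 < Z \<omega>} \<le> prob {\<omega> \<in> space M. Z \<omega> < 0}"
    by (simp add: emeasure_eq_measure)
  moreover have "prob {\<omega> \<in> space M. 0 < Z \<omega>} + prob {\<omega> \<in> space M. Z \<omega> < 0} =
      prob ({\<omega> \<in> space M. 0 < Z \<omega>} \<union> {\<omega> \<in> space M. Z \<omega> < 0})"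
    by (rule finite_measure_Union[symmetric]) auto
  ultimately show ?thesis
    using prob_le_1[of "{\<omega> \<in> space M. 0 < Z \<omega>} \<union> {\<omega> \<in> space M. Z \<omega> < 0}"] by linarith
qed

section \<open>Integration of the pointwise bounds and the final estimate\<close>

theorem theorem2:
  fixes M :: "'a measure" and q :: real and m :: nat and H0 :: "nat set"
    and l :: "nat \<Rightarrow> real" and Z W :: "nat \<Rightarrow> 'a \<Rightarrow> real"
  assumes "prob_space M"
    and "0 < q" and "q < 1"
    and "H0 \<subseteq> {1..m}"
    and "\<And>i. i \<in> H0 \<Longrightarrow> 0 \<le> l i \<and> l i < 1"
    and "\<And>i. i \<in> insert 0 H0 \<Longrightarrow> distributed M lborel (Z i) std_normal_density"
    and "prob_space.indep_vars M (\<lambda>_. borel) Z (insert 0 H0)"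
    and "\<And>i. i \<in> {1..m} \<Longrightarrow> W i \<in> borel_measurable M"
    and "\<And>i. i \<in> H0 \<Longrightarrow> AE \<omega> in M. W i \<omega> = l i * Z 0 \<omega> + sqrt (1 - (l i)\<^sup>2) * Z i \<omega>"
    and "cond_indep_var M
           (PiM ({1..m} - H0) (\<lambda>_. borel)) (\<lambda>\<omega>. \<lambda>j\<in>{1..m} - H0. W j \<omega>)
           (PiM H0 (\<lambda>_. borel)) (\<lambda>\<omega>. \<lambda>i\<in>H0. Z i \<omega>)
           borel (Z 0)"
  shows "FDR M q m H0 W \<le> (1 + q) / 2"
proof -
  interpret prob_space M by fact
  note H0 = \<open>H0 \<subseteq> {1..m}\<close>
  have finH0: "finite H0" using H0 by (rule finite_subset) simp
  let ?nrm = "density lborel std_normal_density"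
  let ?N = "PiM ({1..m} - H0) (\<lambda>_. borel :: real measure)" and ?K = "PiM H0 (\<lambda>_. borel :: real measure)"
  define X where "X \<omega> = (\<lambda>j\<in>{1..m} - H0. W j \<omega>)" for \<omega>
  define Y where "Y \<omega> = (\<lambda>i\<in>H0. Z i \<omega>)" for \<omega>
  have ci: "cond_indep_var M ?N X ?K Y borel (Z 0)"
    using assms(10) by (simp add: X_def[abs_def] Y_def[abs_def])
  then have [measurable]: "X \<in> measurable M ?N" "Y \<in> measurable M ?K" "Z 0 \<in> borel_measurable M"
    by (auto simp: cond_indep_var_def)
  have Z_meas: "Z j \<in> borel_measurable M" if "j \<in> H0" for j
    using distributed_measurable[OF assms(6)[of j]] that by simp
  define P where "P = distr M (?N \<Otimes>\<^sub>M borel) (\<lambda>\<omega>. (X \<omega>, Z 0 \<omega>))"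
  have joint: "distr M ((?N \<Otimes>\<^sub>M borel) \<Otimes>\<^sub>M ?K) (\<lambda>\<omega>. ((X \<omega>, Z 0 \<omega>), Y \<omega>)) = P \<Otimes>\<^sub>M distr M ?K Y"
    unfolding P_def
  proof (rule distr_Pair_of_cond_indep_var[OF ci])
    fix C B assume [measurable]: "C \<in> sets (borel :: real measure)" "B \<in> sets ?K"
    let ?C = "{x \<in> space (PiM {0} (\<lambda>_. borel)). x 0 \<in> C} :: (nat \<Rightarrow> real) set"
    have C: "?C \<in> sets (PiM {0} (\<lambda>_. borel))" by measurable
    \<comment> \<open>The blocks \<open>{0}\<close> and \<open>H0\<close> are disjoint because the
      score indices start at 1.\<close>
    have "indep_var (PiM {0} (\<lambda>_. borel)) (\<lambda>\<omega>. \<lambda>i\<in>{0}. Z i \<omega>) ?K Y"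
      unfolding Y_def[abs_def] using H0 by (intro indep_var_restrict[OF assms(7)]) auto
    from indep_varD[OF this C \<open>B \<in> sets ?K\<close>]
    have "prob ((\<lambda>x. (\<lambda>i\<in>{0}. Z i x, Y x)) -` (?C \<times> B) \<inter> space M) =
      prob ((\<lambda>\<omega>. \<lambda>i\<in>{0}. Z i \<omega>) -` ?C \<inter> space M) * prob (Y -` B \<inter> space M)" .
    moreover have "(\<lambda>x. (\<lambda>i\<in>{0}. Z i x, Y x)) -` (?C \<times> B) \<inter> space M = Z 0 -` C \<inter> space M \<inter> (Y -` B \<inter> space M)"
      "(\<lambda>\<omega>. \<lambda>i\<in>{0}. Z i \<omega>) -` ?C \<inter> space M = Z 0 -` C \<inter> space M"
      by (auto simp: space_PiM)
    ultimately show "prob (Z 0 -` C \<inter> space M \<inter> (Y -` B \<inter> space M)) =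
      prob (Z 0 -` C \<inter> space M) * prob (Y -` B \<inter> space M)" by simp
  qed
  define w where "w = (\<lambda>(x, z0) y j. if j \<in> H0 then l j * z0 + sqrt (1 - (l j)\<^sup>2) * y j else x j)"
  have w_meas: "(\<lambda>(p, y). w p y j) \<in> borel_measurable ((?N \<Otimes>\<^sub>M borel) \<Otimes>\<^sub>M ?K)" if "j \<in> {1..m}" for j
  proof (cases "j \<in> H0")
    case True
    then have [measurable]: "(\<lambda>y. y j) \<in> borel_measurable ?K" by (rule measurable_component_singleton)
    show ?thesis using True unfolding w_def by (simp add: split_beta' del: One_nat_def)
  next
    case False
    then have [measurable]: "(\<lambda>y. y j) \<in> borel_measurable ?N"
      using that by (intro measurable_component_singleton) auto
    show ?thesis using False unfolding w_def by (simp add: split_beta' del: One_nat_def)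
  qed
  \<comment> \<open>\<open>V\<close> satisfies the null model at every point, not only almost
    surely, and is a fixed function of the independent elements \<open>(X, Z 0)\<close> and
    \<open>Y\<close>.\<close>
  define V where "V \<omega> = w (X \<omega>, Z 0 \<omega>) (Y \<omega>)" for \<omega>
  let ?L = "\<lambda>i v. leave_one_out_weight q m H0 i (v(i := \<bar>v i\<bar>))"
  have L_meas: "(\<lambda>(p, y). ?L i (w p y)) \<in> borel_measurable ((?N \<Otimes>\<^sub>M borel) \<Otimes>\<^sub>M ?K)" if i: "i \<in> H0" for i
    unfolding split_beta'
  proof (rule measurable_leave_one_out_weight[OF H0 i])
    fix j assume j: "j \<in> {1..m}"
    have "i \<in> {1..m}" using i H0 by auto
    then show "(\<lambda>x. ((w (fst x) (snd x))(i := \<bar>w (fst x) (snd x) i\<bar>)) j)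
        \<in> borel_measurable ((?N \<Otimes>\<^sub>M borel) \<Otimes>\<^sub>M ?K)"
      using w_meas[of i] w_meas[OF j] by (cases "j = i") (simp_all add: split_beta')
  qed
  have XZY [measurable]: "(\<lambda>\<omega>. ((X \<omega>, Z 0 \<omega>), Y \<omega>)) \<in> measurable M ((?N \<Otimes>\<^sub>M borel) \<Otimes>\<^sub>M ?K)"
    by measurable
  have V_meas: "(\<lambda>\<omega>. V \<omega> i) \<in> borel_measurable M" if "i \<in> H0" for i
    using measurable_compose[OF XZY w_meas[of i]] that H0 by (auto simp: V_def)
  have LV_meas: "(\<lambda>\<omega>. ?L i (V \<omega>)) \<in> borel_measurable M" if "i \<in> H0" for i
    using measurable_compose[OF XZY L_meas[OF that]] by (simp add: V_def)
  \<comment> \<open>The factor restricts to \<open>Z 0 \<le> 0\<close>, where the null shifts are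
    nonpositive and the signs can be compared.\<close>
  define pos where "pos i \<omega> = of_bool (Z 0 \<omega> \<le> 0) * (of_bool (0 < V \<omega> i) * ?L i (V \<omega>))" for i \<omega>
  define neg where "neg i \<omega> = of_bool (Z 0 \<omega> \<le> 0) * (of_bool (V \<omega> i < 0) * ?L i (V \<omega>))" for i \<omega>
  have int: "integrable M (pos i)" "integrable M (neg i)" if "i \<in> H0" for i
  proof -
    note [measurable] = V_meas[OF that] LV_meas[OF that]
    show "integrable M (pos i)" "integrable M (neg i)"
      by (rule integrable_const_bound[where B = 1];
        auto simp: pos_def[abs_def] neg_def[abs_def] of_bool_def leave_one_out_weight_nonneg leave_one_out_weight_le_1)+
  qed
  have pos_neg: "expectation (pos i) \<le> expectation (neg i)" if i: "i \<in> H0" for i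
  proof -
    have "H0 \<noteq> {}" using i by auto
    have "distr M borel (Z j) = ?nrm" if "j \<in> H0" for j
    proof -
      have "distr M borel (Z j) = distr M lborel (Z j)" by (rule distr_cong) auto
      also have "\<dots> = ?nrm" using assms(6)[of j] that by (simp add: distributed_distr_eq_density)
      finally show ?thesis .
    qed
    then have "PiM H0 (\<lambda>j. distr M borel (Z j)) = PiM H0 (\<lambda>_. ?nrm)"
      by (intro PiM_cong) auto
    moreover have "indep_vars (\<lambda>_. borel) Z H0"
      using assms(7) by (rule indep_vars_subset) auto
    ultimately have Y: "distr M ?K Y = PiM H0 (\<lambda>_. ?nrm)"
      using indep_vars_iff_distr_eq_PiM'[OF \<open>H0 \<noteq> {}\<close>, of Z "\<lambda>_. borel"] Z_meas
      by (simp add: Y_def[abs_def])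
    have sets_P: "sets P = sets (?N \<Otimes>\<^sub>M borel)" and sets_Y: "sets (distr M ?K Y) = sets ?K"
      by (simp_all add: P_def)
    interpret PY: prob_space "distr M ?K Y" by (rule prob_space_distr) measurable
    have fubini: "(\<integral>\<^sup>+\<omega>. f ((X \<omega>, Z 0 \<omega>), Y \<omega>) \<partial>M) = (\<integral>\<^sup>+p. \<integral>\<^sup>+y. f (p, y) \<partial>PiM H0 (\<lambda>_. ?nrm) \<partial>P)"
      if f: "f \<in> borel_measurable ((?N \<Otimes>\<^sub>M borel) \<Otimes>\<^sub>M ?K)" for f
    proof -
      have "(\<integral>\<^sup>+\<omega>. f ((X \<omega>, Z 0 \<omega>), Y \<omega>) \<partial>M) = (\<integral>\<^sup>+x. f x \<partial>(P \<Otimes>\<^sub>M distr M ?K Y))"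
        unfolding joint[symmetric] by (rule nn_integral_distr[OF XZY, symmetric]) (use f in simp)
      also have "\<dots> = (\<integral>\<^sup>+p. \<integral>\<^sup>+y. f (p, y) \<partial>distr M ?K Y \<partial>P)"
        using f by (intro PY.nn_integral_fst[symmetric])
          (simp add: measurable_cong_sets[OF sets_pair_measure_cong[OF sets_P sets_Y] refl])
      finally show ?thesis by (simp add: Y)
    qed
    \<comment> \<open>The values 1 and -1 of \<open>s\<close> give the integrands of
      \<open>pos\<close> and \<open>neg\<close>, so one measurability argument serves both.\<close>
    define F where "F s p y = (of_bool (snd p \<le> 0) * (of_bool (0 < s * w p y i) * ennreal (?L i (w p y))))"
      for s :: real and p :: "(nat \<Rightarrow> real) \<times> real" and y
    have F_meas: "(\<lambda>(p, y). F s p y) \<in> borel_measurable ((?N \<Otimes>\<^sub>M borel) \<Otimes>\<^sub>M ?K)" for s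
    proof -
      have [measurable]: "(\<lambda>x. w (fst x) (snd x) i) \<in> borel_measurable ((?N \<Otimes>\<^sub>M borel) \<Otimes>\<^sub>M ?K)"
        "(\<lambda>x. ?L i (w (fst x) (snd x))) \<in> borel_measurable ((?N \<Otimes>\<^sub>M borel) \<Otimes>\<^sub>M ?K)"
        using w_meas[of i] L_meas[OF i] i H0 by (auto simp: split_beta')
      show ?thesis unfolding F_def split_beta' by measurable
    qed
    have "ennreal (expectation (pos i)) = (\<integral>\<^sup>+\<omega>. ennreal (pos i \<omega>) \<partial>M)"
      by (rule nn_integral_eq_integral[OF int(1)[OF i], symmetric]) (simp add: pos_def leave_one_out_weight_nonneg)
    also have "\<dots> = (\<integral>\<^sup>+\<omega>. F 1 (X \<omega>, Z 0 \<omega>) (Y \<omega>) \<partial>M)"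
      by (intro nn_integral_cong) (auto simp: pos_def F_def V_def)
    also have "\<dots> = (\<integral>\<^sup>+p. \<integral>\<^sup>+y. F 1 p y \<partial>PiM H0 (\<lambda>_. ?nrm) \<partial>P)"
      using fubini[OF F_meas] by simp
    also have "\<dots> \<le> (\<integral>\<^sup>+p. \<integral>\<^sup>+y. F (-1) p y \<partial>PiM H0 (\<lambda>_. ?nrm) \<partial>P)"
    proof (rule nn_integral_mono)
      fix p :: "(nat \<Rightarrow> real) \<times> real"
      obtain x z0 where p: "p = (x, z0)" by (cases p)
      show "(\<integral>\<^sup>+y. F 1 p y \<partial>PiM H0 (\<lambda>_. ?nrm)) \<le> (\<integral>\<^sup>+y. F (-1) p y \<partial>PiM H0 (\<lambda>_. ?nrm))"
      proof (cases "z0 \<le> 0")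
        case True
        then show ?thesis
          using nn_integral_null_sign_le[OF H0 i, of l z0 x q] assms(5)[OF i]
          by (simp add: F_def w_def p)
      qed (simp add: F_def p)
    qed
    also have "\<dots> = (\<integral>\<^sup>+\<omega>. F (-1) (X \<omega>, Z 0 \<omega>) (Y \<omega>) \<partial>M)"
      using fubini[OF F_meas] by simp
    also have "\<dots> = (\<integral>\<^sup>+\<omega>. ennreal (neg i \<omega>) \<partial>M)"
      by (intro nn_integral_cong) (auto simp: neg_def F_def V_def)
    also have "\<dots> = ennreal (expectation (neg i))"
      by (rule nn_integral_eq_integral[OF int(2)[OF i]]) (simp add: neg_def leave_one_out_weight_nonneg)
    finally show ?thesis
      by (subst (asm) ennreal_le_iff) (auto simp: neg_def leave_one_out_weight_nonneg intro!: integral_nonneg_AE)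
  qed
  have "AE \<omega> in M. \<forall>i\<in>H0. W i \<omega> = l i * Z 0 \<omega> + sqrt (1 - (l i)\<^sup>2) * Z i \<omega>"
    using finH0 assms(9) by (intro AE_finite_allI) auto
  then have FDP_V: "AE \<omega> in M. FDP q m H0 (\<lambda>i. W i \<omega>) = FDP q m H0 (V \<omega>)"
  proof eventually_elim
    case (elim \<omega>)
    then show ?case by (intro FDP_cong) (auto simp: V_def w_def X_def Y_def)
  qed
  let ?p = "prob {\<omega> \<in> space M. 0 < Z 0 \<omega>}"
  have ind: "expectation (\<lambda>\<omega>. of_bool (0 < Z 0 \<omega>)) = ?p" "integrable M (\<lambda>\<omega>. of_bool (0 < Z 0 \<omega>) :: real)"
    "expectation (\<lambda>\<omega>. of_bool (Z 0 \<omega> \<le> 0)) = 1 - ?p" "integrable M (\<lambda>\<omega>. of_bool (Z 0 \<omega> \<le> 0) :: real)"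
  proof -
    show i: "integrable M (\<lambda>\<omega>. of_bool (0 < Z 0 \<omega>) :: real)"
      by (rule integrable_const_bound[where B = 1]) auto
    have "expectation (\<lambda>\<omega>. of_bool (0 < Z 0 \<omega>)) = expectation (indicator {\<omega> \<in> space M. 0 < Z 0 \<omega>})"
      by (intro Bochner_Integration.integral_cong) auto
    also have "\<dots> = ?p" by (simp add: Int_absorb2 subset_eq)
    finally show e: "expectation (\<lambda>\<omega>. of_bool (0 < Z 0 \<omega>)) = ?p" .
    have "(\<lambda>\<omega>. of_bool (Z 0 \<omega> \<le> 0) :: real) = (\<lambda>\<omega>. 1 - of_bool (0 < Z 0 \<omega>))" by (auto simp: fun_eq_iff)
    with i e show "expectation (\<lambda>\<omega>. of_bool (Z 0 \<omega> \<le> 0)) = 1 - ?p"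
      "integrable M (\<lambda>\<omega>. of_bool (Z 0 \<omega> \<le> 0) :: real)"
      by (simp_all add: prob_space)
  qed
  have "FDR M q m H0 W \<le> expectation (\<lambda>\<omega>. of_bool (0 < Z 0 \<omega>) + q * (\<Sum>i\<in>H0. pos i \<omega>))"
    unfolding FDR_def
  \<comment> \<open>This comparison asks for integrability and nonnegativity of the majorant only; a
    nonintegrable function would have integral 0 by convention.\<close>
  proof (rule integral_mono_AE')
    show "integrable M (\<lambda>\<omega>. of_bool (0 < Z 0 \<omega>) + q * (\<Sum>i\<in>H0. pos i \<omega>))"
      using ind int by (intro Bochner_Integration.integrable_add integrable_mult_right Bochner_Integration.integrable_sum) auto
    show "AE \<omega> in M. FDP q m H0 (\<lambda>i. W i \<omega>) \<le> of_bool (0 < Z 0 \<omega>) + q * (\<Sum>i\<in>H0. pos i \<omega>)"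
      using FDP_V
    proof eventually_elim
      case (elim \<omega>)
      show ?case
      proof (cases "Z 0 \<omega> \<le> 0")
        case True
        then show ?thesis using FDP_le_sum_leave_one_out[OF H0 \<open>0 < q\<close>, of "V \<omega>"] elim by (simp add: pos_def)
      next
        case False
        then show ?thesis using FDP_le_1 by (simp add: pos_def)
      qed
    qed
    show "AE \<omega> in M. 0 \<le> of_bool (0 < Z 0 \<omega>) + q * (\<Sum>i\<in>H0. pos i \<omega>)"
      using \<open>0 < q\<close> by (auto simp: pos_def leave_one_out_weight_nonneg intro!: AE_I2 add_nonneg_nonneg mult_nonneg_nonneg sum_nonneg)
  qed
  also have "\<dots> = ?p + q * (\<Sum>i\<in>H0. expectation (pos i))"
    using ind int by simp
  also have "\<dots> \<le> ?p + q * (\<Sum>i\<in>H0. expectation (neg i))"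
    using \<open>0 < q\<close> by (simp add: sum_mono pos_neg)
  also have "(\<Sum>i\<in>H0. expectation (neg i)) = expectation (\<lambda>\<omega>. \<Sum>i\<in>H0. neg i \<omega>)"
    using int by simp
  also have "\<dots> \<le> expectation (\<lambda>\<omega>. of_bool (Z 0 \<omega> \<le> 0))"
  proof (rule integral_mono)
    show "(\<Sum>i\<in>H0. neg i \<omega>) \<le> of_bool (Z 0 \<omega> \<le> 0)" for \<omega>
      using sum_leave_one_out_neg_le_1[OF H0, of "V \<omega>" q] by (auto simp: neg_def)
  qed (use int ind in auto)
  also have "\<dots> = 1 - ?p" by (fact ind)
  finally have "FDR M q m H0 W \<le> ?p + q * (1 - ?p)" using \<open>0 < q\<close> by simp
  \<comment> \<open>Since \<open>q < 1\<close>, this form is increasing in \<open>?p\<close>, so the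
    bound of one half on \<open>?p\<close> can be inserted.\<close>
  also have "\<dots> = q + (1 - q) * ?p" by (simp add: algebra_simps)
  also have "\<dots> \<le> q + (1 - q) * (1 / 2)"
    using \<open>q < 1\<close> prob_std_normal_pos_le_half[OF assms(6)[of 0]] by (intro add_left_mono mult_left_mono) auto
  finally show ?thesis by (simp add: field_simps)
qed

end
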